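(* Let $J_{15}=J_{15,0}$ be the color graph of order 15 and rank 5 obtained by the switching $Sw_0$ from the symmetrization $NJ_{15}$ of the rank 6 association scheme of 2-orbits of the transitive action of $A_5$ on 15 points. Then $J_{15}$ is a Jordan scheme.
   Context: A Jordan scheme on a finite set $\Omega$ is a partition of $\Omega^2$ into nonempty symmetric relations, one of which is the identity relation, such that the real linear span of the adjacency matrices is closed under the Jordan product $A*B=\frac12(AB+BA)$. Setting: let $\Omega$ be the set of the 15 structures $\{\{a,b\},\{c,d\}\}$, where $\{a,b\}$ and $\{c,d\}$ are disjoint 2-subsets of $\{0,1,2,3,4\}$, with the natural transitive action of the alternating group $A_5$. The orbits of $A_5$ on $\Omega^2$ (2-orbits) are: the identity relation, two mutually transposed relations $S_1,S_2=S_1^T$ of valency 1, and three symmetric relations $\Delta_0,\Delta_1,\Delta_2$ of valency 4. The symmetrization $NJ_{15}$ has relations $\mathrm{Id}_{15}$, $S=S_1\cup S_2$, $\Delta_0,\Delta_1,\Delta_2$. The relation $\mathrm{Id}_{15}\cup S$ is an equivalence relation with five classes (fibers) of size 3. Fix one fiber (the island, with 3 points); the remaining 12 points form the continent. Let $T_i$ (denoted $TT_i$ in the paper) be the restriction of $\Delta_i$ to the continent and let the bridge $Br_i$ be the set of pairs of $\Delta_i$ (in both directions) between island and continent, so that $\Delta_i=T_i\cup Br_i$. The switching $Sw_0$ keeps $Br_0$ and interchanges $Br_1$ and $Br_2$: the color graph $J_{15}=J_{15,0}$ has the five relations $\mathrm{Id}_{15}$, $S$, $\Delta_0$, $\Delta'_1=T_1\cup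 Br_2$, $\Delta'_2=T_2\cup Br_1$. *)

theory Defs
  imports Complex_Main "HOL-Library.Disjoint_Sets" "HOL-Combinatorics.Permutations"
begin

section \<open>Jordan schemes\<close>

text \<open>Real matrices with rows and columns indexed by a finite set \<open>\<Omega>\<close> are represented as
  functions \<^typ>\<open>'a \<Rightarrow> 'a \<Rightarrow> real\<close>. The matrices considered below vanish outside \<open>\<Omega> \<times> \<Omega>\<close>,
  so that equality of functions is equality of \<open>\<Omega> \<times> \<Omega>\<close> matrices.\<close>

definition adjacency_matrix :: "('a \<times> 'a) set \<Rightarrow> 'a \<Rightarrow> 'a \<Rightarrow> real" where
  "adjacency_matrix R = (\<lambda>x y. if (x, y) \<in> R then 1 else 0)"

definition matrix_product :: "'a set \<Rightarrow> ('a \<Rightarrow> 'a \<Rightarrow> real) \<Rightarrow> ('a \<Rightarrow> 'a \<Rightarrow> real) \<Rightarrow> 'a \<Rightarrow> 'a \<Rightarrow> real" where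
  "matrix_product \<Omega> A B = (\<lambda>x y. \<Sum>z\<in>\<Omega>. A x z * B z y)"

definition jordan_product :: "'a set \<Rightarrow> ('a \<Rightarrow> 'a \<Rightarrow> real) \<Rightarrow> ('a \<Rightarrow> 'a \<Rightarrow> real) \<Rightarrow> 'a \<Rightarrow> 'a \<Rightarrow> real" where
  "jordan_product \<Omega> A B =
     (\<lambda>x y. 1 / 2 * (matrix_product \<Omega> A B x y + matrix_product \<Omega> B A x y))"

text \<open>Used for finite \<open>\<C>\<close> only: a partition of \<open>\<Omega> \<times> \<Omega>\<close> has finitely many classes.\<close>

definition adjacency_span :: "('a \<times> 'a) set set \<Rightarrow> ('a \<Rightarrow> 'a \<Rightarrow> real) set" where
  "adjacency_span \<C> =
     {M. \<exists>c :: ('a \<times> 'a) set \<Rightarrow> real. M = (\<lambda>x y. \<Sum>R\<in>\<C>. c R * adjacency_matrix R x y)}"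

text \<open>Nonemptiness of the classes is part of \<^const>\<open>partition_on\<close>.\<close>

definition jordan_scheme :: "'a set \<Rightarrow> ('a \<times> 'a) set set \<Rightarrow> bool" where
  "jordan_scheme \<Omega> \<C> \<longleftrightarrow>
     finite \<Omega> \<and> partition_on (\<Omega> \<times> \<Omega>) \<C> \<and> (\<forall>R\<in>\<C>. sym R) \<and> Id_on \<Omega> \<in> \<C> \<and>
     (\<forall>A\<in>adjacency_span \<C>. \<forall>B\<in>adjacency_span \<C>. jordan_product \<Omega> A B \<in> adjacency_span \<C>)"


section \<open>The action of the alternating group of degree 5 on 15 points\<close>

definition A5 :: "(nat \<Rightarrow> nat) set" where
  "A5 = {p. p permutes {0, 1, 2, 3, 4} \<and> evenperm p}"

definition Omega15 :: "nat set set set" where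
  "Omega15 = {{{a, b}, {c, d}} | a b c d. {a, b, c, d} \<subseteq> {0, 1, 2, 3, 4} \<and> distinct [a, b, c, d]}"

definition act :: "(nat \<Rightarrow> nat) \<Rightarrow> nat set set \<Rightarrow> nat set set" where
  "act p s = (\<lambda>e. p ` e) ` s"

definition two_orbits :: "(nat set set \<times> nat set set) set set" where
  "two_orbits = {{(act p s, act p t) | p. p \<in> A5} | s t. s \<in> Omega15 \<and> t \<in> Omega15}"

definition has_valency :: "'a set \<Rightarrow> ('a \<times> 'a) set \<Rightarrow> nat \<Rightarrow> bool" where
  "has_valency \<Omega> R k \<longleftrightarrow> (\<forall>x\<in>\<Omega>. card (R `` {x}) = k)"


section \<open>Switching with respect to an island\<close>

text \<open>In the following definitions \<open>I\<close> is the island, and \<open>\<Omega> - I\<close> is the continent.\<close>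

definition continent_part :: "'a set \<Rightarrow> 'a set \<Rightarrow> ('a \<times> 'a) set \<Rightarrow> ('a \<times> 'a) set" where
  "continent_part \<Omega> I R = R \<inter> ((\<Omega> - I) \<times> (\<Omega> - I))"

definition bridge :: "'a set \<Rightarrow> 'a set \<Rightarrow> ('a \<times> 'a) set \<Rightarrow> ('a \<times> 'a) set" where
  "bridge \<Omega> I R = R \<inter> (I \<times> (\<Omega> - I) \<union> (\<Omega> - I) \<times> I)"

definition switched_graph ::
  "'a set \<Rightarrow> 'a set \<Rightarrow> ('a \<times> 'a) set \<Rightarrow> ('a \<times> 'a) set \<Rightarrow> ('a \<times> 'a) set \<Rightarrow> ('a \<times> 'a) set \<Rightarrow> ('a \<times> 'a) set set" where
  "switched_graph \<Omega> I S \<Delta>0 \<Delta>1 \<Delta>2 =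
     {Id_on \<Omega>, S, \<Delta>0,
      continent_part \<Omega> I \<Delta>1 \<union> bridge \<Omega> I \<Delta>2,
      continent_part \<Omega> I \<Delta>2 \<union> bridge \<Omega> I \<Delta>1}"

text \<open>The labelling of the three symmetric 2-orbits of valency 4 is not determined by the
  action; the predicate admits every labelling, and either choice of \<open>S1\<close>.\<close>

definition NJ15_labelling ::
  "(nat set set \<times> nat set set) set \<Rightarrow> (nat set set \<times> nat set set) set \<Rightarrow>
   (nat set set \<times> nat set set) set \<Rightarrow> (nat set set \<times> nat set set) set \<Rightarrow> bool" where
  "NJ15_labelling S1 \<Delta>0 \<Delta>1 \<Delta>2 \<longleftrightarrow>
     two_orbits = {Id_on Omega15, S1, S1\<inverse>, \<Delta>0, \<Delta>1, \<Delta>2} \<and>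
     distinct [Id_on Omega15, S1, S1\<inverse>, \<Delta>0, \<Delta>1, \<Delta>2] \<and>
     has_valency Omega15 S1 1 \<and> has_valency Omega15 (S1\<inverse>) 1 \<and>
     (\<forall>R\<in>{\<Delta>0, \<Delta>1, \<Delta>2}. sym R \<and> has_valency Omega15 R 4)"

end

theory Submission
  imports Defs
begin

text \<open>The proof rests on two facts about the action: the 2-orbits of a group form a coherent
  configuration (the number of paths between two points through two given classes depends only on the
  class of the pair, lemma \<open>coherent_two_orbits\<close>), and the valencies are 1, 1, 1, 4, 4, 4.

  From these data the structure is forced. The relation \<open>S1\<close> is the graph of a fixed-point-free
  permutation \<open>s\<close> with \<open>s\<^sup>3 = 1\<close>, whose orbits are the fibres. Moving one entry of a pair by \<open>s\<close>
  permutes the three classes of valency 4 without fixed points, since a neighbourhood of size 4 is not a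
  union of fibres of size 3. So the classes can be named \<open>D 0\<close>, \<open>D 1\<close>, \<open>D 2\<close>, with indices modulo 3,
  such that a step along a fibre raises the colour by one (\<open>cyclic_cover_exists\<close>). In particular each
  point is joined to each other fibre exactly once in every colour, which gives 3 + 12 = 15 points. Moving
  the end points and the midpoint of a path along their fibres shows that between points of different
  fibres there is exactly one path for each ordered pair of colours (\<open>paths_D\<close>).

  The switching negates the colours modulo 3 on the bridges. By bilinearity the Jordan property means that
  the numbers of paths with colours \<open>(i, j)\<close> and \<open>(j, i)\<close> add up to a constant on every class
  (\<open>jordan_schemeI\<close>). For end points in different fibres this holds since the number of paths through a
  fixed third fibre depends only on the difference of the colours: negating both colours of a path
  through the island amounts to interchanging them, which is invisible after symmetrization
  (\<open>sw_paths_off\<close>). For distinct end points in one fibre it follows from row and column sums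
  (\<open>sw_paths_fibre\<close>).\<close>

section \<open>A criterion for Jordan schemes\<close>

definition paths :: "('a \<times> 'a) set \<Rightarrow> ('a \<times> 'a) set \<Rightarrow> 'a \<Rightarrow> 'a \<Rightarrow> nat" where
  "paths R T x y = card {z. (x, z) \<in> R \<and> (z, y) \<in> T}"

lemma paths_sym:
  assumes "sym R" "sym T"
  shows "paths R T x y = paths T R y x"
proof -
  have "{z. (x, z) \<in> R \<and> (z, y) \<in> T} = {z. (y, z) \<in> T \<and> (z, x) \<in> R}"
    using assms by (auto dest: symD)
  then show ?thesis by (simp add: paths_def)
qed

lemma sum_adjacency_matrix:
  assumes "finite \<Omega>" "R \<subseteq> \<Omega> \<times> \<Omega>"
  shows "(\<Sum>z\<in>\<Omega>. adjacency_matrix R x z * adjacency_matrix T z y) = real (paths R T x y)"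
proof -
  have "(\<Sum>z\<in>\<Omega>. adjacency_matrix R x z * adjacency_matrix T z y)
      = (\<Sum>z\<in>\<Omega>. if z \<in> {z. (x, z) \<in> R \<and> (z, y) \<in> T} then 1 else 0)"
    by (intro sum.cong) (auto simp: adjacency_matrix_def)
  also have "\<dots> = real (card (\<Omega> \<inter> {z. (x, z) \<in> R \<and> (z, y) \<in> T}))"
    using assms(1) by (simp add: sum.If_cases)
  also have "\<Omega> \<inter> {z. (x, z) \<in> R \<and> (z, y) \<in> T} = {z. (x, z) \<in> R \<and> (z, y) \<in> T}"
    using assms(2) by auto
  finally show ?thesis by (simp add: paths_def)
qed

lemma matrix_product_span:
  assumes "finite \<Omega>" "finite \<C>" "\<And>R. R \<in> \<C> \<Longrightarrow> R \<subseteq> \<Omega> \<times> \<Omega>"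
  shows "matrix_product \<Omega> (\<lambda>x y. \<Sum>R\<in>\<C>. a R * adjacency_matrix R x y)
           (\<lambda>x y. \<Sum>T\<in>\<C>. b T * adjacency_matrix T x y) x y
       = (\<Sum>R\<in>\<C>. \<Sum>T\<in>\<C>. a R * b T * real (paths R T x y))"
proof -
  have "matrix_product \<Omega> (\<lambda>x y. \<Sum>R\<in>\<C>. a R * adjacency_matrix R x y)
           (\<lambda>x y. \<Sum>T\<in>\<C>. b T * adjacency_matrix T x y) x y
      = (\<Sum>z\<in>\<Omega>. \<Sum>R\<in>\<C>. \<Sum>T\<in>\<C>. a R * b T * (adjacency_matrix R x z * adjacency_matrix T z y))"
    by (simp add: matrix_product_def sum_product mult_ac)
  also have "\<dots> = (\<Sum>R\<in>\<C>. \<Sum>z\<in>\<Omega>. \<Sum>T\<in>\<C>. a R * b T * (adjacency_matrix R x z * adjacency_matrix T z y))"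
    by (rule sum.swap)
  also have "\<dots> = (\<Sum>R\<in>\<C>. \<Sum>T\<in>\<C>. \<Sum>z\<in>\<Omega>. a R * b T * (adjacency_matrix R x z * adjacency_matrix T z y))"
    by (intro sum.cong refl sum.swap)
  also have "\<dots> = (\<Sum>R\<in>\<C>. \<Sum>T\<in>\<C>. a R * b T * real (paths R T x y))"
    by (intro sum.cong refl)
      (simp add: sum_distrib_left[symmetric] sum_adjacency_matrix assms)
  finally show ?thesis .
qed

text \<open>The Jordan product is bilinear, so closure has to be tested on pairs of basis matrices only.
  For classes \<open>R\<close> and \<open>T\<close> the entry of \<open>2 (R * T)\<close> at \<open>(x, y)\<close> counts the paths from \<open>x\<close> to \<open>y\<close>
  with one step in \<open>R\<close> and one in \<open>T\<close>, in either order. A matrix lies in the span iff it is constant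
  on classes and vanishes outside \<open>\<Omega> \<times> \<Omega>\<close>. The class of the diagonal acts as
  the unit, so the condition is imposed on the other classes.\<close>

lemma jordan_schemeI:
  assumes fin: "finite \<Omega>" and part: "partition_on (\<Omega> \<times> \<Omega>) \<C>"
    and sym: "\<And>R. R \<in> \<C> \<Longrightarrow> sym R" and Id: "Id_on \<Omega> \<in> \<C>"
    and const: "\<And>R T U x y x' y'. \<lbrakk>R \<in> \<C> - {Id_on \<Omega>}; T \<in> \<C> - {Id_on \<Omega>}; U \<in> \<C>;
        (x, y) \<in> U; (x', y') \<in> U\<rbrakk>
      \<Longrightarrow> paths R T x y + paths T R x y = paths R T x' y' + paths T R x' y'"
  shows "jordan_scheme \<Omega> \<C>"
proof -
  define w where "w R T x y = paths R T x y + paths T R x y" for R T x and y :: 'a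
  have sub: "R \<subseteq> \<Omega> \<times> \<Omega>" if "R \<in> \<C>" for R
    using that partition_onD1[OF part] by blast
  have finC: "finite \<C>"
    using finite_elements[OF _ part] fin by simp
  have uniq: "U = V" if "U \<in> \<C>" "V \<in> \<C>" "p \<in> U" "p \<in> V" for U V p
    using partition_onD2[OF part] that by (auto simp: disjoint_def)
  have Idl: "paths (Id_on \<Omega>) T x y = (if (x, y) \<in> T then 1 else 0)"
    and Idr: "paths T (Id_on \<Omega>) x y = (if (x, y) \<in> T then 1 else 0)" if "T \<in> \<C>" for T x y
  proof -
    have "{z. (x, z) \<in> Id_on \<Omega> \<and> (z, y) \<in> T} = (if (x, y) \<in> T then {x} else {})"
      "{z. (x, z) \<in> T \<and> (z, y) \<in> Id_on \<Omega>} = (if (x, y) \<in> T then {y} else {})"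
      using sub[OF that] by auto
    then show "paths (Id_on \<Omega>) T x y = (if (x, y) \<in> T then 1 else 0)"
      "paths T (Id_on \<Omega>) x y = (if (x, y) \<in> T then 1 else 0)"
      by (simp_all add: paths_def)
  qed
  have w_const: "w R T x y = w R T x' y'"
    if "R \<in> \<C>" "T \<in> \<C>" "U \<in> \<C>" "(x, y) \<in> U" "(x', y') \<in> U" for R T U x y x' y'
  proof -
    have mem: "(x, y) \<in> V \<longleftrightarrow> (x', y') \<in> V" if "V \<in> \<C>" for V
      using uniq \<open>U \<in> \<C>\<close> \<open>(x, y) \<in> U\<close> \<open>(x', y') \<in> U\<close> that by blast
    show ?thesis
    proof (cases "R = Id_on \<Omega> \<or> T = Id_on \<Omega>")
      case True
      then show ?thesis using that mem by (auto simp: w_def Idl Idr)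
    next
      case False
      then show ?thesis using const[of R T U x y x' y'] that by (simp add: w_def)
    qed
  qed
  have "jordan_product \<Omega> A B \<in> adjacency_span \<C>"
    if AB: "A \<in> adjacency_span \<C>" "B \<in> adjacency_span \<C>" for A B
  proof -
    obtain a b :: "('a \<times> 'a) set \<Rightarrow> real"
      where A: "A = (\<lambda>x y. \<Sum>R\<in>\<C>. a R * adjacency_matrix R x y)"
        and B: "B = (\<lambda>x y. \<Sum>T\<in>\<C>. b T * adjacency_matrix T x y)"
      using AB unfolding adjacency_span_def by blast
    define J where "J x y = (\<Sum>R\<in>\<C>. \<Sum>T\<in>\<C>. a R * b T * real (w R T x y)) / 2" for x y
    have BA: "(\<Sum>R\<in>\<C>. \<Sum>T\<in>\<C>. b R * a T * real (paths R T x y))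
        = (\<Sum>R\<in>\<C>. \<Sum>T\<in>\<C>. a R * b T * real (paths T R x y))" for x y
      by (subst sum.swap) (simp add: mult_ac)
    have prod: "jordan_product \<Omega> A B x y = J x y" for x y
    proof -
      have "matrix_product \<Omega> A B x y = (\<Sum>R\<in>\<C>. \<Sum>T\<in>\<C>. a R * b T * real (paths R T x y))"
        unfolding A B by (rule matrix_product_span) (use fin finC sub in auto)
      moreover have "matrix_product \<Omega> B A x y = (\<Sum>R\<in>\<C>. \<Sum>T\<in>\<C>. b R * a T * real (paths R T x y))"
        unfolding A B by (rule matrix_product_span) (use fin finC sub in auto)
      ultimately show ?thesis
        unfolding jordan_product_def J_def w_def
        by (simp add: BA sum.distrib[symmetric] distrib_left)
    qed
    have J_const: "J x y = J x' y'" if "U \<in> \<C>" "(x, y) \<in> U" "(x', y') \<in> U" for U x y x' y'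
      unfolding J_def using w_const[OF _ _ that] by simp
    \<comment> \<open>Classes are nonempty, so the coefficient of a class can be read off at any of its pairs.\<close>
    define c where "c U = (let p = (SOME p. p \<in> U) in J (fst p) (snd p))" for U
    have c: "c U = J x y" if "U \<in> \<C>" "(x, y) \<in> U" for U x y
    proof -
      have "(SOME p. p \<in> U) \<in> U" using that(2) by (rule someI)
      then show ?thesis
        unfolding c_def Let_def using J_const[OF that(1) _ that(2)] by (metis prod.collapse)
    qed
    have "J x y = (\<Sum>U\<in>\<C>. c U * adjacency_matrix U x y)" for x y
    proof (cases "(x, y) \<in> \<Omega> \<times> \<Omega>")
      case True
      then obtain U where U: "U \<in> \<C>" "(x, y) \<in> U"
        using partition_onD1[OF part] by auto
      have "(\<Sum>V\<in>\<C>. c V * adjacency_matrix V x y) = (\<Sum>V\<in>\<C>. if V = U then c U else 0)"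
      proof (rule sum.cong)
        fix V assume "V \<in> \<C>"
        then have "(x, y) \<in> V \<longleftrightarrow> V = U" using uniq U by blast
        then show "c V * adjacency_matrix V x y = (if V = U then c U else 0)"
          by (simp add: adjacency_matrix_def)
      qed simp
      then show ?thesis using U finC c by simp
    next
      case False
      then have no: "(x, y) \<notin> U" if "U \<in> \<C>" for U using sub[OF that] by blast
      have "w R T x y = 0" if "R \<in> \<C>" "T \<in> \<C>" for R T
      proof -
        have "{z. (x, z) \<in> R \<and> (z, y) \<in> T} = {}" "{z. (x, z) \<in> T \<and> (z, y) \<in> R} = {}"
          using False sub that by blast+
        then show ?thesis unfolding w_def paths_def by (simp only: card.empty add_0)
      qed
      then show ?thesis using no by (simp add: J_def adjacency_matrix_def)
    qed
    then have "jordan_product \<Omega> A B = (\<lambda>x y. \<Sum>U\<in>\<C>. c U * adjacency_matrix U x y)"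
      using prod by (intro ext) simp
    then show ?thesis unfolding adjacency_span_def by blast
  qed
  then show ?thesis
    using fin part sym Id by (simp add: jordan_scheme_def)
qed

section \<open>The 2-orbits form a coherent configuration\<close>

definition coherent :: "('a \<times> 'a) set set \<Rightarrow> bool" where
  "coherent \<C> \<longleftrightarrow> (\<forall>R\<in>\<C>. \<forall>T\<in>\<C>. \<forall>U\<in>\<C>. \<forall>x y x' y'.
     (x, y) \<in> U \<longrightarrow> (x', y') \<in> U \<longrightarrow> paths R T x y = paths R T x' y')"

lemma act_id: "act id s = s"
  by (simp add: act_def)

lemma act_comp: "act (p \<circ> q) s = act p (act q s)"
  by (simp add: act_def image_image image_comp[symmetric] del: image_comp)

lemma A5_id: "id \<in> A5"
  by (simp add: A5_def permutes_id)

lemma A5_comp: "p \<in> A5 \<Longrightarrow> q \<in> A5 \<Longrightarrow> p \<circ> q \<in> A5"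
  by (auto simp: A5_def evenperm_comp permutes_imp_permutation[rotated] intro: permutes_compose)

lemma A5_inv:
  assumes "p \<in> A5"
  shows "inv p \<in> A5" "p \<circ> inv p = id" "inv p \<circ> p = id"
proof -
  have p: "p permutes {0, 1, 2, 3, 4}" "evenperm p" using assms by (auto simp: A5_def)
  then have "permutation p" by (auto intro: permutes_imp_permutation[rotated])
  then show "inv p \<in> A5"
    using p by (simp add: A5_def permutes_inv evenperm_inv)
  show "p \<circ> inv p = id" "inv p \<circ> p = id"
    using permutes_inv_o[OF p(1)] by auto
qed

lemma act_inv:
  assumes "p \<in> A5"
  shows "act (inv p) (act p s) = s" "act p (act (inv p) s) = s"
  using A5_inv[OF assms] by (simp_all add: act_comp[symmetric] act_id)

lemma act_Omega15:
  assumes "p \<in> A5" "s \<in> Omega15"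
  shows "act p s \<in> Omega15"
proof -
  obtain a b c d where s: "s = {{a, b}, {c, d}}" "{a, b, c, d} \<subseteq> {0, 1, 2, 3, 4}"
    "distinct [a, b, c, d]"
    using assms(2) unfolding Omega15_def by blast
  have p: "p permutes {0, 1, 2, 3, 4}" using assms(1) by (auto simp: A5_def)
  have "p ` {a, b, c, d} \<subseteq> {0, 1, 2, 3, 4}" 
    using image_mono[OF s(2), of p] by (simp only: permutes_image[OF p])
  then have "{p a, p b, p c, p d} \<subseteq> {0, 1, 2, 3, 4}" by simp
  moreover have "distinct [p a, p b, p c, p d]"
    using s(3) permutes_inj[OF p] by (simp add: inj_eq)
  moreover have "act p s = {{p a, p b}, {p c, p d}}"
    by (simp add: act_def s(1))
  ultimately show ?thesis unfolding Omega15_def by blast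
qed

lemma finite_Omega15: "finite Omega15"
proof (rule finite_subset)
  show "Omega15 \<subseteq> Pow (Pow {0, 1, 2, 3, 4})"
    unfolding Omega15_def by auto
qed simp

text \<open>A 2-orbit is generated by each of its pairs. This uses that \<open>A5\<close> is closed under
  composition and inverses, and makes the 2-orbits a partition.\<close>

lemma two_orbits_transitive:
  assumes "U \<in> two_orbits" "(x, y) \<in> U"
  shows "U = {(act p x, act p y) | p. p \<in> A5}"
proof -
  obtain s t where U: "U = {(act p s, act p t) | p. p \<in> A5}"
    using assms(1) unfolding two_orbits_def by blast
  then obtain q where q: "q \<in> A5" "x = act q s" "y = act q t"
    using assms(2) by blast
  have "\<exists>r\<in>A5. act p s = act r x \<and> act p t = act r y" if "p \<in> A5" for p
    using that q A5_comp[OF that A5_inv(1)[OF q(1)]]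
    by (intro bexI[of _ "p \<circ> inv q"]) (auto simp: act_comp act_inv)
  moreover have "\<exists>r\<in>A5. act p x = act r s \<and> act p y = act r t" if "p \<in> A5" for p
    using that q A5_comp[OF that q(1)] by (intro bexI[of _ "p \<circ> q"]) (auto simp: act_comp)
  ultimately show ?thesis unfolding U by blast
qed

lemma partition_two_orbits: "partition_on (Omega15 \<times> Omega15) two_orbits"
proof (rule partition_onI)
  show "\<Union> two_orbits = Omega15 \<times> Omega15"
  proof
    show "\<Union> two_orbits \<subseteq> Omega15 \<times> Omega15"
      using act_Omega15 unfolding two_orbits_def by auto
    have "\<exists>U\<in>two_orbits. (s, t) \<in> U" if "s \<in> Omega15" "t \<in> Omega15" for s t
    proof
      show "{(act p s, act p t) | p. p \<in> A5} \<in> two_orbits"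
        unfolding two_orbits_def using that by blast
      have "(s, t) = (act id s, act id t)" by (simp add: act_id)
      then show "(s, t) \<in> {(act p s, act p t) | p. p \<in> A5}" using A5_id by blast
    qed
    then show "Omega15 \<times> Omega15 \<subseteq> \<Union> two_orbits" by auto
  qed
  show "disjnt U V" if "U \<in> two_orbits" "V \<in> two_orbits" "U \<noteq> V" for U V
  proof (rule ccontr)
    assume "\<not> disjnt U V"
    then obtain x y where "(x, y) \<in> U" "(x, y) \<in> V" unfolding disjnt_def by auto
    then show False
      using that two_orbits_transitive[of U x y] two_orbits_transitive[of V x y] by simp
  qed
  show "{} \<notin> two_orbits"
    using A5_id unfolding two_orbits_def by auto
qed

text \<open>An element of \<open>A5\<close> that carries \<open>(x, y)\<close> to \<open>(x', y')\<close> preserves every 2-orbit, so it maps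
  the midpoints of the paths from \<open>x\<close> to \<open>y\<close> bijectively to those from \<open>x'\<close> to \<open>y'\<close>.\<close>

lemma coherent_two_orbits: "coherent two_orbits"
  unfolding coherent_def
proof (intro ballI allI impI)
  fix R T U x y x' y'
  assume R: "R \<in> two_orbits" and T: "T \<in> two_orbits" and U: "U \<in> two_orbits"
    and xy: "(x, y) \<in> U" "(x', y') \<in> U"
  have inv: "(act p s, act p t) \<in> V" if "V \<in> two_orbits" "(s, t) \<in> V" "p \<in> A5" for V p s t
    using two_orbits_transitive[OF that(1,2)] that(3) by blast
  obtain p where p: "p \<in> A5" "x' = act p x" "y' = act p y"
    using two_orbits_transitive[OF U xy(1)] xy(2) by blast
  have "bij_betw (act p) {z. (x, z) \<in> R \<and> (z, y) \<in> T} {z. (x', z) \<in> R \<and> (z, y') \<in> T}"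
  proof (rule bij_betw_byWitness[where f' = "act (inv p)"])
    show "act p ` {z. (x, z) \<in> R \<and> (z, y) \<in> T} \<subseteq> {z. (x', z) \<in> R \<and> (z, y') \<in> T}"
      using inv[OF R _ p(1)] inv[OF T _ p(1)] p by auto
    show "act (inv p) ` {z. (x', z) \<in> R \<and> (z, y') \<in> T} \<subseteq> {z. (x, z) \<in> R \<and> (z, y) \<in> T}"
      using inv[OF R _ A5_inv(1)[OF p(1)]] inv[OF T _ A5_inv(1)[OF p(1)]] p
      by clarsimp (metis act_inv(1))
  qed (use p act_inv in auto)
  then show "paths R T x y = paths R T x' y'"
    unfolding paths_def by (rule bij_betw_same_card)
qed

section \<open>Triple covers of the complete graph with cyclic colours\<close>

lemma mod3_cases: "(k :: int) mod 3 = 0 \<or> k mod 3 = 1 \<or> k mod 3 = 2"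
  using pos_mod_bound[of 3 k] pos_mod_sign[of 3 k] by linarith

lemma mod3_shift:
  "((k :: int) + 1) mod 3 = (if k mod 3 = 2 then 0 else k mod 3 + 1)"
  "((k :: int) + 2) mod 3 = (if k mod 3 = 0 then 2 else k mod 3 - 1)"
  using mod3_cases[of k] by (elim disjE; subst mod_add_left_eq[symmetric], simp)+

text \<open>The orbits of \<open>s\<close> are fibres of size 3, and the relations \<open>D k\<close>, with colours \<open>k\<close> read modulo 3,
  colour the pairs in different fibres. The decisive axiom is \<open>D_shift\<close>: moving an end point along its
  fibre raises the colour by one. Since the \<open>D k\<close> are symmetric this holds for both end points, so with
  \<open>\<int>/3\<close>-coordinates on the fibres \<open>f\<close>, \<open>g\<close> the colour of a pair is the sum of the two coordinates plus
  a constant depending on \<open>f\<close> and \<open>g\<close>. Colours are integers rather than residues, so that \<open>k + 1\<close> and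
  \<open>- k\<close> make sense without reduction.\<close>

locale cyclic_cover =
  fixes \<Omega> :: "'a set" and s :: "'a \<Rightarrow> 'a" and D :: "int \<Rightarrow> ('a \<times> 'a) set"
  assumes fin: "finite \<Omega>"
    and s_in: "x \<in> \<Omega> \<Longrightarrow> s x \<in> \<Omega>"
    and s_cube: "x \<in> \<Omega> \<Longrightarrow> s (s (s x)) = x"
    and s_neq: "x \<in> \<Omega> \<Longrightarrow> s x \<noteq> x"
    and D_sub: "D k \<subseteq> \<Omega> \<times> \<Omega>"
    and D_sym: "sym (D k)"
    and D_irrefl: "(x, x) \<notin> D k"
    and D_mod: "j mod 3 = k mod 3 \<Longrightarrow> D j = D k"
    and D_disj: "(x, y) \<in> D j \<Longrightarrow> (x, y) \<in> D k \<Longrightarrow> j mod 3 = k mod 3"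
    and D_shift: "(x, y) \<in> D k \<Longrightarrow> (s x, y) \<in> D (k + 1)"
    and D_cover: "x \<in> \<Omega> \<Longrightarrow> y \<in> \<Omega> \<Longrightarrow> y \<notin> {x, s x, s (s x)} \<Longrightarrow> \<exists>k. (x, y) \<in> D k"
    and D_valency: "x \<in> \<Omega> \<Longrightarrow> card (D k `` {x}) = 4"
    and D_coherent: "(x, y) \<in> D k \<Longrightarrow> (x', y') \<in> D k \<Longrightarrow>
      paths (D i) (D j) x y = paths (D i) (D j) x' y'"
begin

definition fibre :: "'a \<Rightarrow> 'a set" where
  "fibre x = {x, s x, s (s x)}"

lemma s2_neq: "x \<in> \<Omega> \<Longrightarrow> s (s x) \<noteq> x" "x \<in> \<Omega> \<Longrightarrow> s (s x) \<noteq> s x"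
  using s_cube s_neq s_in by metis+

lemma fibre_sub: "x \<in> \<Omega> \<Longrightarrow> fibre x \<subseteq> \<Omega>"
  by (simp add: fibre_def s_in)

lemma card_fibre: "x \<in> \<Omega> \<Longrightarrow> card (fibre x) = 3"
  using s_neq[of x] s2_neq[of x] by (auto simp: fibre_def)

lemma fibre_eq: "x \<in> \<Omega> \<Longrightarrow> y \<in> fibre x \<Longrightarrow> fibre y = fibre x"
  by (auto simp: fibre_def s_cube)

lemma fibre_s: "x \<in> \<Omega> \<Longrightarrow> fibre (s x) = fibre x"
  by (rule fibre_eq) (auto simp: fibre_def)

lemma fibre_self: "x \<in> fibre x"
  by (simp add: fibre_def)

lemma fibre_sym: "x \<in> \<Omega> \<Longrightarrow> y \<in> \<Omega> \<Longrightarrow> y \<in> fibre x \<longleftrightarrow> x \<in> fibre y"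
  using fibre_eq fibre_self by metis

lemma D_in: "(x, y) \<in> D k \<Longrightarrow> x \<in> \<Omega> \<and> y \<in> \<Omega>"
  using D_sub by blast

lemma D_commute: "(x, y) \<in> D k \<longleftrightarrow> (y, x) \<in> D k"
  using D_sym by (auto dest: symD)

lemma D_s: "x \<in> \<Omega> \<Longrightarrow> (s x, y) \<in> D (k + 1) \<longleftrightarrow> (x, y) \<in> D k"
proof
  assume "x \<in> \<Omega>" "(s x, y) \<in> D (k + 1)"
  then have "(x, y) \<in> D (k + 1 + 1 + 1)"
    using D_shift s_cube by metis
  moreover have "D (k + 1 + 1 + 1) = D k" by (rule D_mod) presburger
  ultimately show "(x, y) \<in> D k" by simp
qed (rule D_shift)

lemma D_s_right: "y \<in> \<Omega> \<Longrightarrow> (x, s y) \<in> D (k + 1) \<longleftrightarrow> (x, y) \<in> D k"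
  using D_s D_commute by metis

lemma D_fibre: 
  assumes "(x, y) \<in> D k"
  shows "y \<notin> fibre x"
proof
  assume "y \<in> fibre x"
  have "x \<in> \<Omega>" using D_in[OF assms] by simp
  then have "(x, y) \<in> D k" "(s x, y) \<in> D (k + 1)" "(s (s x), y) \<in> D (k + 1 + 1)"
    using assms D_shift by blast+
  then show False using \<open>y \<in> fibre x\<close> D_irrefl by (auto simp: fibre_def)
qed

lemma D_three:
  assumes "x \<in> \<Omega>" "y \<in> \<Omega>" "y \<notin> fibre x"
  shows "(x, y) \<in> D 0 \<or> (x, y) \<in> D 1 \<or> (x, y) \<in> D 2"
proof -
  obtain k where k: "(x, y) \<in> D k"
    using D_cover[of x y] assms unfolding fibre_def by auto
  then show ?thesis
    using mod3_cases[of k] D_mod[of k 0] D_mod[of k 1] D_mod[of k 2] by auto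
qed

text \<open>The colours of \<open>(x, y)\<close>, \<open>(x, s y)\<close>, \<open>(x, s (s y))\<close> are three consecutive residues, so each
  colour occurs exactly once among them.\<close>

lemma D_meets_fibre:
  assumes "x \<in> \<Omega>" "y \<in> \<Omega>" "y \<notin> fibre x"
  shows "card (D k `` {x} \<inter> fibre y) = 1"
proof -
  obtain j where j: "(x, y) \<in> D j" using D_three[OF assms] by auto
  then have j1: "(x, s y) \<in> D (j + 1)" and j2: "(x, s (s y)) \<in> D (j + 2)"
    using D_s_right[of y x j] D_s_right[of "s y" x "j + 1"] assms s_in by (auto simp: add.assoc)
  have *: "(x, z) \<in> D k \<longleftrightarrow> i mod 3 = k mod 3" if "(x, z) \<in> D i" for z i
    using that D_disj D_mod by metis
  have "D k `` {x} \<inter> fibre y = (if j mod 3 = k mod 3 then {y} else if (j + 1) mod 3 = k mod 3 then {s y} else {s (s y)})"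
  proof -
    have "(j + 2) mod 3 = k mod 3 \<longleftrightarrow> \<not> j mod 3 = k mod 3 \<and> \<not> (j + 1) mod 3 = k mod 3"
      "\<not> (j mod 3 = k mod 3 \<and> (j + 1) mod 3 = k mod 3)"
      using mod3_cases[of k] mod3_cases[of j] by (auto simp: mod3_shift)
    then show ?thesis using *[OF j] *[OF j1] *[OF j2] by (auto simp: fibre_def)
  qed
  then show ?thesis by simp
qed

lemma card_Omega:
  assumes "x \<in> \<Omega>"
  shows "card \<Omega> = 15"
proof -
  have \<Omega>: "\<Omega> = fibre x \<union> (D 0 `` {x} \<union> (D 1 `` {x} \<union> D 2 `` {x}))"
    using D_three[OF assms] fibre_sub[OF assms] D_in by auto
  have "finite (D k `` {x})" for k
    by (rule finite_subset[OF _ fin]) (use D_sub in auto)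
  moreover have "finite (fibre x)" by (simp add: fibre_def)
  moreover have "D i `` {x} \<inter> D j `` {x} = {}" if "i mod 3 \<noteq> j mod 3" for i j
    using D_disj that by blast
  moreover have "fibre x \<inter> D k `` {x} = {}" for k using D_fibre by blast
  ultimately show ?thesis
    unfolding \<Omega> using card_fibre[OF assms] D_valency[OF assms]
    by (simp add: card_Un_disjoint Int_Un_distrib)
qed

text \<open>Stated for a family \<open>F\<close> that three-colours the pairs between different fibres, because
  it is applied both to \<open>D\<close> and to its switching: every step in \<open>R\<close> from \<open>x\<close> to a point outside the fibre
  of \<open>y\<close> continues to \<open>y\<close> in exactly one colour.\<close>

lemma row_sum:
  assumes F3: "\<And>z. z \<in> \<Omega> \<Longrightarrow> z \<notin> fibre y \<Longrightarrow> (z, y) \<in> F 0 \<or> (z, y) \<in> F 1 \<or> (z, y) \<in> F (2::int)"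
    and F: "\<And>z i j. (z, y) \<in> F i \<Longrightarrow> (z, y) \<in> F j \<Longrightarrow> i mod 3 = j mod 3"
    and Fib: "\<And>z k. (z, y) \<in> F k \<Longrightarrow> z \<notin> fibre y"
    and R: "R \<subseteq> \<Omega> \<times> \<Omega>"
  shows "paths R (F 0) x y + paths R (F 1) x y + paths R (F 2) x y = card (R `` {x} - fibre y)"
proof -
  define A where "A k = {z. (x, z) \<in> R \<and> (z, y) \<in> F k}" for k
  have "R `` {x} - fibre y = A 0 \<union> (A 1 \<union> A 2)"
    using F3 Fib R unfolding A_def by auto
  moreover have "finite (A k)" for k
    unfolding A_def by (rule finite_subset[OF _ fin]) (use R in auto)
  moreover have "A i \<inter> A j = {}" if "i mod 3 \<noteq> j mod 3" for i j
    using F that unfolding A_def by blast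
  ultimately show ?thesis
    by (simp add: card_Un_disjoint Int_Un_distrib paths_def A_def[symmetric])
qed

text \<open>Moving the midpoint along its fibre raises both colours of the path. The restriction to
  a union \<open>I\<close> of fibres is for paths through the island only.\<close>

lemma shift_middle:
  assumes I: "\<And>z. z \<in> \<Omega> \<Longrightarrow> s z \<in> I \<longleftrightarrow> z \<in> I"
  shows "card {z \<in> I. (x, z) \<in> D (i + 1) \<and> (z, y) \<in> D (j + 1)} = card {z \<in> I. (x, z) \<in> D i \<and> (z, y) \<in> D j}"
    (is "card ?B = card ?A")
proof -
  have "bij_betw s ?A ?B"
  proof (rule bij_betw_byWitness[where f' = "\<lambda>z. s (s z)"])
    show "s ` ?A \<subseteq> ?B"
      using I D_in by (auto simp: D_s D_s_right)
    show "(\<lambda>z. s (s z)) ` ?B \<subseteq> ?A"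
    proof clarify
      fix z assume z: "z \<in> I" "(x, z) \<in> D (i + 1)" "(z, y) \<in> D (j + 1)"
      then have in\<Omega>: "z \<in> \<Omega>" "s z \<in> \<Omega>" "s (s z) \<in> \<Omega>" using D_in s_in by blast+
      then have "s (s z) \<in> I" using I z by simp
      moreover have "(x, s (s z)) \<in> D i" "(s (s z), y) \<in> D j"
        using D_s[of "s (s z)"] D_s_right[of "s (s z)"] in\<Omega> z s_cube by simp_all
      ultimately show "s (s z) \<in> I \<and> (x, s (s z)) \<in> D i \<and> (s (s z), y) \<in> D j" by simp
    qed
  qed (use D_in s_cube in blast)+
  then show ?thesis by (rule bij_betw_same_card[symmetric])
qed

text \<open>Moving both end points raises both colours of a path by one, and so does moving the midpoint.
  Hence \<open>(x, y)\<close> and \<open>(s x, s y)\<close> are joined by equally many paths with colours \<open>i\<close>, \<open>j\<close>, although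
  their own colours differ by two. By coherence this number therefore does not depend on the colour of
  \<open>(x, y)\<close>; moving only \<open>y\<close> then shows that it does not depend on \<open>j\<close> either. Of the four neighbours
  of \<open>x\<close> in colour \<open>i\<close> one lies in the fibre of \<open>y\<close>, and the other three are distributed equally over
  the three values of \<open>j\<close>.\<close>

lemma paths_D:
  assumes x: "x \<in> \<Omega>" and y: "y \<in> \<Omega>" and xy: "y \<notin> fibre x"
  shows "paths (D i) (D j) x y = 1"
proof -
  have right: "paths (D i) (D (j + 1)) x (s y) = paths (D i) (D j) x y" if "y \<in> \<Omega>" for i j x y
    using D_s_right that by (simp add: paths_def)
  have left: "paths (D (i + 1)) (D j) (s x) y = paths (D i) (D j) x y" if "x \<in> \<Omega>" for i j x y
    using D_s that by (simp add: paths_def)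
  have middle: "paths (D (i + 1)) (D (j + 1)) x y = paths (D i) (D j) x y" for i j x y
    using shift_middle[of UNIV x i y j] by (simp add: paths_def)
  have per: "paths (D i) (D (j + 2)) x y = paths (D i) (D j) x y"
    if y: "y \<in> \<Omega>" and xy: "y \<notin> fibre x" for j y
  proof -
    define u where "u = s y"
    have u: "u \<in> \<Omega>" "s u \<in> \<Omega>" "s (s u) = y" using y s_in s_cube u_def by auto
    have "u \<notin> fibre x"
      using xy x y u fibre_sym fibre_s by (metis u_def)
    then obtain k where k: "(x, u) \<in> D k" using D_three x u by blast
    have "(s x, s u) \<in> D (k + 1 + 1)" "(x, s (s u)) \<in> D (k + 1 + 1)"
      using k D_s D_s_right x u by blast+
    then have "paths (D i) (D j) (s x) (s u) = paths (D i) (D j) x (s (s u))"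
      by (rule D_coherent)
    moreover have "paths (D i) (D j) (s x) (s u) = paths (D i) (D j) x u"
      using middle[of i j "s x" "s u"] left[OF x, of i "j + 1" "s u"] right[OF u(1), of i j x] by simp
    moreover have "paths (D i) (D (j + 2)) x (s (s u)) = paths (D i) (D j) x u"
      using right[OF u(2), of i "j + 1" x] right[OF u(1), of i j x] by (simp add: add.assoc)
    ultimately show ?thesis using u by simp
  qed
  have "D (2 + 2) = D 1" by (rule D_mod) simp
  then have eqs: "paths (D i) (D 2) x y = paths (D i) (D 0) x y" "paths (D i) (D 1) x y = paths (D i) (D 2) x y"
    using per[OF y xy, of 0] per[OF y xy, of 2] by simp_all
  have fin': "finite (D i `` {x})"
    by (rule finite_subset[OF _ fin]) (use D_sub in auto)
  have "paths (D i) (D 0) x y + paths (D i) (D 1) x y + paths (D i) (D 2) x y = card (D i `` {x} - fibre y)"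
  proof (rule row_sum)
    show "(z, y) \<in> D 0 \<or> (z, y) \<in> D 1 \<or> (z, y) \<in> D 2" if "z \<in> \<Omega>" "z \<notin> fibre y" for z
      using D_three[OF y that] D_commute by blast
    show "z \<notin> fibre y" if "(z, y) \<in> D k" for z k
      using that D_fibre D_commute by blast
  qed (use D_disj D_sub in blast)+
  also have "\<dots> = 3"
    using card_Diff_subset_Int[of "D i `` {x}" "fibre y"] fin' D_valency[OF x] D_meets_fibre[OF x y xy]
    by simp
  finally have one: "paths (D i) (D k) x y = 1" if "k \<in> {0, 1, 2}" for k
    using eqs that by auto
  have "D j = D (j mod 3)" by (rule D_mod) simp
  moreover have "j mod 3 \<in> {0, 1, 2}" using mod3_cases[of j] by simp
  ultimately show ?thesis using one by metis
qed

end

section \<open>The switching\<close>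

locale switched_cover = cyclic_cover +
  fixes I :: "'a set"
  assumes island: "\<exists>a\<in>\<Omega>. I = fibre a"
begin

definition bridge_sign :: "'a \<Rightarrow> 'a \<Rightarrow> int" where
  "bridge_sign x y = (if x \<in> I \<longleftrightarrow> y \<in> I then 1 else -1)"

text \<open>Negation of colours fixes colour 0 and interchanges 1 and 2, so applying it to the bridges
  only is the switching that keeps colour 0.\<close>

definition sw :: "int \<Rightarrow> ('a \<times> 'a) set" where
  "sw k = {(x, y). (x, y) \<in> D (bridge_sign x y * k)}"

definition S :: "('a \<times> 'a) set" where
  "S = {(x, y). x \<in> \<Omega> \<and> y \<in> fibre x \<and> y \<noteq> x}"

lemma I_fibre: "x \<in> I \<Longrightarrow> fibre x = I"
  using island fibre_eq by auto

lemma in_I_fibre: "x \<in> \<Omega> \<Longrightarrow> y \<in> fibre x \<Longrightarrow> y \<in> I \<longleftrightarrow> x \<in> I"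
  using I_fibre fibre_eq fibre_self by metis

lemma s_in_I: "x \<in> \<Omega> \<Longrightarrow> s x \<in> I \<longleftrightarrow> x \<in> I"
  by (rule in_I_fibre) (auto simp: fibre_def)

lemma bridge_sign_commute: "bridge_sign x y = bridge_sign y x"
  by (auto simp: bridge_sign_def)

lemma bridge_sign_fibre: "x \<in> \<Omega> \<Longrightarrow> y \<in> fibre x \<Longrightarrow> bridge_sign y z = bridge_sign x z"
  by (simp add: bridge_sign_def in_I_fibre)

lemma bridge_sign_square: "bridge_sign x y * (bridge_sign x y * k) = k"
  by (auto simp: bridge_sign_def)

lemma mod3_minus: "(- i :: int) mod 3 = (- j) mod 3 \<longleftrightarrow> i mod 3 = j mod 3"
  by (metis mod_minus_cong minus_minus)

lemma mod3_bridge_sign: "(bridge_sign x y * i) mod 3 = (bridge_sign x y * j) mod 3 \<longleftrightarrow> i mod 3 = j mod 3"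
  using mod3_minus by (simp add: bridge_sign_def)

lemma sw_mod: "i mod 3 = j mod 3 \<Longrightarrow> sw i = sw j"
  unfolding sw_def using D_mod mod3_bridge_sign by blast

lemma sw_disj: "(x, y) \<in> sw i \<Longrightarrow> (x, y) \<in> sw j \<Longrightarrow> i mod 3 = j mod 3"
  unfolding sw_def using D_disj mod3_bridge_sign by blast

lemma sw_sub: "sw k \<subseteq> \<Omega> \<times> \<Omega>"
  unfolding sw_def using D_sub by blast

lemma sw_commute: "(x, y) \<in> sw k \<longleftrightarrow> (y, x) \<in> sw k"
  by (simp add: sw_def bridge_sign_commute[of y x]) (rule D_commute)

lemma sw_sym: "sym (sw k)"
  using sw_commute by (auto intro: symI)

lemma sw_fibre: "(x, y) \<in> sw k \<Longrightarrow> y \<notin> fibre x"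
  unfolding sw_def using D_fibre by blast

lemma sw_irrefl: "(x, x) \<notin> sw k"
  using sw_fibre fibre_self by blast

lemma sw_three:
  assumes "x \<in> \<Omega>" "y \<in> \<Omega>" "y \<notin> fibre x"
  shows "(x, y) \<in> sw 0 \<or> (x, y) \<in> sw 1 \<or> (x, y) \<in> sw 2"
proof -
  obtain k where "(x, y) \<in> D k" using D_three[OF assms] by auto
  then have "(x, y) \<in> sw (bridge_sign x y * k)" by (simp add: sw_def bridge_sign_square)
  then show ?thesis
    using mod3_cases[of "bridge_sign x y * k"] sw_mod[of "bridge_sign x y * k" 0] sw_mod[of "bridge_sign x y * k" 1]
      sw_mod[of "bridge_sign x y * k" 2] by auto
qed

lemma finite_row: "finite (D k `` {x})"
  by (rule finite_subset[OF _ fin]) (use D_sub in auto)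

text \<open>A point outside the island has exactly one neighbour of each colour in the island, so the
  switching removes one neighbour and adds one.\<close>

lemma sw_valency:
  assumes x: "x \<in> \<Omega>"
  shows "card (sw k `` {x}) = 4"
proof (cases "x \<in> I")
  case True
  have "sw k `` {x} = D (- k) `` {x}"
    using True D_fibre I_fibre[OF True] by (auto simp: sw_def bridge_sign_def)
  then show ?thesis by (simp add: D_valency[OF x])
next
  case False
  obtain a where a: "a \<in> \<Omega>" "I = fibre a" using island by blast
  have meet: "card (D j `` {x} \<inter> I) = 1" for j
    unfolding a(2) using False a fibre_sym x by (intro D_meets_fibre) auto
  have "sw k `` {x} = (D k `` {x} - I) \<union> (D (- k) `` {x} \<inter> I)"
    using False by (auto simp: sw_def bridge_sign_def)
  moreover have "card (D k `` {x} - I) = 3"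
    using card_Diff_subset_Int[of "D k `` {x}" I] finite_row D_valency[OF x] meet by simp
  moreover have "(D k `` {x} - I) \<inter> (D (- k) `` {x} \<inter> I) = {}" by blast
  ultimately show ?thesis
    using meet[of "- k"] finite_row by (simp add: card_Un_disjoint)
qed

lemma sw_row_sum:
  assumes x: "x \<in> \<Omega>" and y: "y \<in> fibre x"
  shows "paths (sw i) (sw 0) x y + paths (sw i) (sw 1) x y + paths (sw i) (sw 2) x y = 4"
proof -
  have y': "y \<in> \<Omega>" using fibre_sub x y by blast
  have "paths (sw i) (sw 0) x y + paths (sw i) (sw 1) x y + paths (sw i) (sw 2) x y
      = card (sw i `` {x} - fibre y)"
  proof (rule row_sum)
    show "(z, y) \<in> sw 0 \<or> (z, y) \<in> sw 1 \<or> (z, y) \<in> sw 2" if "z \<in> \<Omega>" "z \<notin> fibre y" for z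
      using sw_three[OF y' that] sw_commute by blast
    show "z \<notin> fibre y" if "(z, y) \<in> sw k" for z k
      using that sw_fibre sw_commute by blast
  qed (use sw_disj sw_sub in blast)+
  also have "sw i `` {x} - fibre y = sw i `` {x}"
    using fibre_eq[OF x y] sw_fibre by blast
  finally show ?thesis by (simp add: sw_valency[OF x])
qed

text \<open>A midpoint \<open>z\<close> sees the points \<open>x\<close> and \<open>y\<close> of one fibre with the same bridge sign, hence in two
  different colours after the switching as well as before.\<close>

lemma sw_paths_diag:
  assumes x: "x \<in> \<Omega>" and y: "y \<in> fibre x" "y \<noteq> x"
  shows "paths (sw i) (sw i) x y = 0"
proof -
  have no: False if "(x, z) \<in> sw i" "(z, y) \<in> sw i" for z
  proof -
    define k where "k = bridge_sign x z * i"
    have xz: "(x, z) \<in> D k" and yz: "(y, z) \<in> D k"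
      using that sw_commute[of z y] bridge_sign_fibre[OF x y(1)] by (auto simp: sw_def k_def)
    have "(s x, z) \<in> D (k + 1)" "(s (s x), z) \<in> D (k + 2)"
      using D_shift[OF xz] D_shift[OF D_shift[OF xz]] by (auto simp: add.assoc)
    then show False
      using y yz D_disj[of y z k "k + 1"] D_disj[of y z k "k + 2"] mod3_cases[of k]
      by (auto simp: fibre_def mod3_shift split: if_splits)
  qed
  have "{z. (x, z) \<in> sw i \<and> (z, y) \<in> sw i} = {}" using no by blast
  then show ?thesis unfolding paths_def by (simp only: card.empty)
qed

lemma sw_paths_refl:
  assumes x: "x \<in> \<Omega>"
  shows "paths (sw i) (sw j) x x = (if i mod 3 = j mod 3 then 4 else 0)"
proof -
  have "{z. (x, z) \<in> sw i \<and> (z, x) \<in> sw j} = (if i mod 3 = j mod 3 then sw i `` {x} else {})"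
    using sw_disj[of x _ i j] sw_commute[of x _ j] sw_mod[of i j] by auto
  then show ?thesis by (simp add: paths_def sw_valency[OF x])
qed

text \<open>For fixed points \<open>x\<close>, \<open>y\<close> of a fibre the numbers of paths with colours \<open>i\<close>, \<open>j\<close> form a 3 by 3
  matrix with zero diagonal whose rows and columns all sum to 4. Such a matrix is determined by one entry,
  and opposite entries sum to 4. The individual entries need not agree over all pairs: here the
  symmetrization is essential.\<close>

lemma sw_paths_fibre:
  assumes x: "x \<in> \<Omega>" and y: "y \<in> fibre x" "y \<noteq> x" and ij: "i \<in> {0, 1, 2}" "j \<in> {0, 1, 2}"
  shows "paths (sw i) (sw j) x y + paths (sw j) (sw i) x y = (if i = j then 0 else 4)"
proof -
  have y': "y \<in> \<Omega>" "x \<in> fibre y" using fibre_sub fibre_sym x y by blast+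
  have col: "paths (sw 0) (sw k) x y + paths (sw 1) (sw k) x y + paths (sw 2) (sw k) x y = 4" for k
    using sw_row_sum[OF y', of k] by (simp add: paths_sym[OF sw_sym sw_sym, of k _ y x])
  show ?thesis
    using ij sw_paths_diag[OF x y, of 0] sw_paths_diag[OF x y, of 1] sw_paths_diag[OF x y, of 2]
      sw_row_sum[OF x y(1), of 0] sw_row_sum[OF x y(1), of 1] sw_row_sum[OF x y(1), of 2]
      col[of 0] col[of 1] col[of 2]
    by auto
qed

text \<open>The number of paths through \<open>J\<close> depends only on the difference of the two colours, and
  \<open>(- i, - j)\<close> has the same difference as \<open>(j, i)\<close>.\<close>

lemma shift_middle_diff:
  assumes "\<And>z. z \<in> \<Omega> \<Longrightarrow> s z \<in> J \<longleftrightarrow> z \<in> J"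
  shows "card {z \<in> J. (x, z) \<in> D (- i) \<and> (z, y) \<in> D (- j)} = card {z \<in> J. (x, z) \<in> D j \<and> (z, y) \<in> D i}"
proof -
  have *: "card {z \<in> J. (x, z) \<in> D (a + int n) \<and> (z, y) \<in> D (b + int n)}
      = card {z \<in> J. (x, z) \<in> D a \<and> (z, y) \<in> D b}" for n a b
  proof (induction n)
    case (Suc n)
    then show ?case
      using shift_middle[of J x "a + int n" y "b + int n", OF assms] by (simp add: ac_simps)
  qed simp
  define n where "n = nat ((i + j) mod 3)"
  have n: "int n = (i + j) mod 3" by (simp add: n_def)
  have "D (- i + int n) = D j" "D (- j + int n) = D i"
    unfolding n by (rule D_mod; simp add: mod_simps)+
  then show ?thesis using *[of "- i" n "- j"] by simp
qed

text \<open>If one of the points is in the island, then the switching negates one of the two colours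
  uniformly along all paths, so there is one path for each ordered pair of colours. If both points are in
  the continent, then only paths through the island change: their colours \<open>(i, j)\<close> become \<open>(- i, - j)\<close>,
  which are as frequent as \<open>(j, i)\<close>. The sum over both orders of the colours is thus the one before the
  switching.\<close>

lemma sw_paths_off:
  assumes x: "x \<in> \<Omega>" and y: "y \<in> \<Omega>" and xy: "y \<notin> fibre x"
  shows "paths (sw i) (sw j) x y + paths (sw j) (sw i) x y = 2"
proof -
  have one: "paths (D i) (D j) x y = 1" for i j by (rule paths_D[OF x y xy])
  have noI: "z \<notin> I" if "a \<in> I" "(a, z) \<in> D k \<or> (z, a) \<in> D k" for a z k
    using that D_fibre I_fibre D_commute by blast
  consider "x \<in> I" "y \<notin> I" | "x \<notin> I" "y \<in> I" | "x \<notin> I" "y \<notin> I"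
    using I_fibre xy by blast
  then show ?thesis
  proof cases
    case 1
    have "paths (sw i) (sw j) x y = paths (D (- i)) (D j) x y" for i j
      unfolding paths_def sw_def bridge_sign_def using 1 noI[of x]
      by (intro arg_cong[of _ _ card]) auto
    then show ?thesis by (simp add: one)
  next
    case 2
    have "paths (sw i) (sw j) x y = paths (D i) (D (- j)) x y" for i j
      unfolding paths_def sw_def bridge_sign_def using 2 noI[of y]
      by (intro arg_cong[of _ _ card]) auto
    then show ?thesis by (simp add: one)
  next
    case 3
    define q where "q J a b = card {z \<in> J. (x, z) \<in> D a \<and> (z, y) \<in> D b}" for J a b
    have finite: "finite {z \<in> J. (x, z) \<in> D a \<and> (z, y) \<in> D b}" for J a b
      by (rule finite_subset[OF _ fin]) (use D_sub in auto)
      \<comment> \<open>Both counts are split according to whether the midpoint lies in the island.\<close>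
    have D_split: "paths (D a) (D b) x y = q (- I) a b + q I a b" for a b
    proof -
      have "{z. (x, z) \<in> D a \<and> (z, y) \<in> D b}
          = {z \<in> - I. (x, z) \<in> D a \<and> (z, y) \<in> D b} \<union> {z \<in> I. (x, z) \<in> D a \<and> (z, y) \<in> D b}"
        by blast
      then show ?thesis
        unfolding paths_def q_def by (simp only:, intro card_Un_disjoint finite) blast
    qed
    have sw_split: "paths (sw a) (sw b) x y = q (- I) a b + q I (- a) (- b)" for a b
    proof -
      have "{z. (x, z) \<in> sw a \<and> (z, y) \<in> sw b}
          = {z \<in> - I. (x, z) \<in> D a \<and> (z, y) \<in> D b} \<union> {z \<in> I. (x, z) \<in> D (- a) \<and> (z, y) \<in> D (- b)}"
        using 3 by (auto simp: sw_def bridge_sign_def)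
      then show ?thesis
        unfolding paths_def q_def by (simp only:, intro card_Un_disjoint finite) blast
    qed
    have "q I (- a) (- b) = q I b a" for a b
      unfolding q_def by (rule shift_middle_diff) (rule s_in_I)
    then show ?thesis
      using sw_split[of i j] sw_split[of j i] D_split[of i j] D_split[of j i] one[of i j] one[of j i] by simp
  qed
qed

lemma paths_S_S:
  assumes x: "x \<in> \<Omega>"
  shows "paths S S x y = (if y = x then 2 else if y \<in> fibre x then 1 else 0)"
proof -
  have S: "(x, z) \<in> S \<longleftrightarrow> z \<in> fibre x \<and> z \<noteq> x" for z using x by (simp add: S_def)
  have "(z, y) \<in> S \<longleftrightarrow> y \<in> fibre x \<and> y \<noteq> z" if "z \<in> fibre x" for z
    using that fibre_eq[OF x that] fibre_sub[OF x] by (auto simp: S_def)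
  then have eq: "{z. (x, z) \<in> S \<and> (z, y) \<in> S} = (if y \<in> fibre x then fibre x - {x} - {y} else {})"
    using S by auto
  have "finite (fibre x)" by (simp add: fibre_def)
  then show ?thesis
    using card_fibre[OF x] fibre_self[of x] unfolding paths_def eq by (simp add: card_Diff_singleton_if)
qed

lemma paths_S_sw_fibre:
  assumes x: "x \<in> \<Omega>" and y: "y \<in> fibre x"
  shows "paths S (sw j) x y = 0"
proof -
  have "(z, y) \<notin> sw j" if "(x, z) \<in> S" for z
    using that sw_fibre[of z y j] fibre_eq[OF x, of z] y by (auto simp: S_def)
  then have "{z. (x, z) \<in> S \<and> (z, y) \<in> sw j} = {}" by blast
  then show ?thesis unfolding paths_def by (simp only: card.empty)
qed

text \<open>The two other points of the fibre of \<open>x\<close> are joined to \<open>y\<close> in the two colours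
  different from that of \<open>(x, y)\<close>.\<close>

lemma paths_S_sw:
  assumes xy: "(x, y) \<in> sw k"
  shows "paths S (sw j) x y = (if k mod 3 = j mod 3 then 0 else 1)"
proof -
  have x: "x \<in> \<Omega>" using xy sw_sub by blast
  have mem: "(z, y) \<in> sw j \<longleftrightarrow> i mod 3 = (bridge_sign x y * j) mod 3" if "(z, y) \<in> D i" "z \<in> fibre x" for z i
  proof -
    have "(z, y) \<in> sw j \<longleftrightarrow> (z, y) \<in> D (bridge_sign x y * j)"
      by (simp add: sw_def bridge_sign_fibre[OF x that(2)])
    then show ?thesis using D_disj D_mod that(1) by metis
  qed
  define i where "i = bridge_sign x y * k"
  have D: "(x, y) \<in> D i" using xy by (simp add: sw_def i_def)
  then have D12: "(s x, y) \<in> D (i + 1)" "(s (s x), y) \<in> D (i + 2)"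
    using D_shift[OF D] D_shift[OF D_shift[OF D]] by (auto simp: add.assoc)
  have neq: "s x \<noteq> x" "s (s x) \<noteq> x" "s (s x) \<noteq> s x"
    using s_neq[OF x] s2_neq[OF x] by auto
  define m where "m = bridge_sign x y * j"
  have "{z. (x, z) \<in> S \<and> (z, y) \<in> sw j} = {z \<in> {s x, s (s x)}. (z, y) \<in> sw j}"
    using x neq by (auto simp: S_def fibre_def)
  also have "\<dots> = (if i mod 3 = m mod 3 then {} else if (i + 1) mod 3 = m mod 3 then {s x} else {s (s x)})"
  proof -
    have "(s x, y) \<in> sw j \<longleftrightarrow> (i + 1) mod 3 = m mod 3" "(s (s x), y) \<in> sw j \<longleftrightarrow> (i + 2) mod 3 = m mod 3"
      unfolding m_def by (rule mem; use D12 in \<open>simp add: fibre_def\<close>)+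
    moreover have "(i + 2) mod 3 = m mod 3 \<longleftrightarrow> \<not> i mod 3 = m mod 3 \<and> \<not> (i + 1) mod 3 = m mod 3"
      "\<not> (i mod 3 = m mod 3 \<and> (i + 1) mod 3 = m mod 3)"
      using mod3_cases[of i] mod3_cases[of m] by (auto simp: mod3_shift)
    ultimately show ?thesis by auto
  qed
  finally have "paths S (sw j) x y = (if i mod 3 = m mod 3 then 0 else 1)"
    by (simp add: paths_def)
  then show ?thesis by (simp add: i_def m_def mod3_bridge_sign)
qed

lemma S_sym: "sym S"
proof (rule symI)
  fix x y assume "(x, y) \<in> S"
  then have xy: "x \<in> \<Omega>" "y \<in> fibre x" "y \<noteq> x" by (auto simp: S_def)
  then have "y \<in> \<Omega>" using fibre_sub by blast
  then show "(y, x) \<in> S" using xy fibre_sym[of x y] by (simp add: S_def)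
qed

definition classes :: "('a \<times> 'a) set set" where
  "classes = {Id_on \<Omega>, S, sw 0, sw 1, sw 2}"

lemma classes_disjoint:
  "Id_on \<Omega> \<inter> S = {}" "Id_on \<Omega> \<inter> sw k = {}" "S \<inter> sw k = {}"
  "i mod 3 \<noteq> j mod 3 \<Longrightarrow> sw i \<inter> sw j = {}"
proof -
  show "Id_on \<Omega> \<inter> sw k = {}" using sw_irrefl by blast
  show "Id_on \<Omega> \<inter> S = {}" unfolding S_def by blast
  show "S \<inter> sw k = {}" unfolding S_def using sw_fibre by blast
  show "sw i \<inter> sw j = {}" if "i mod 3 \<noteq> j mod 3" using sw_disj that by auto
qed

lemma classes_nonempty:
  "Id_on \<Omega> \<noteq> {}" "S \<noteq> {}" "sw k \<noteq> {}"
proof -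
  obtain a where a: "a \<in> \<Omega>" using island by blast
  then show "Id_on \<Omega> \<noteq> {}" by blast
  have "(a, s a) \<in> S" using a s_neq by (simp add: S_def fibre_def)
  then show "S \<noteq> {}" by blast
  show "sw k \<noteq> {}" using sw_valency[OF a, of k] by auto
qed

lemma card_classes: "card classes = 5"
proof -
  have "A \<noteq> B" if "A \<inter> B = {}" "A \<noteq> {}" for A B :: "('a \<times> 'a) set" using that by blast
  then have "distinct [Id_on \<Omega>, S, sw 0, sw 1, sw 2]"
    using classes_disjoint classes_nonempty by simp
  then have "card (set [Id_on \<Omega>, S, sw 0, sw 1, sw 2]) = 5"
    by (simp only: distinct_card) simp
  then show ?thesis by (simp add: classes_def)
qed

lemma partition_classes: "partition_on (\<Omega> \<times> \<Omega>) classes"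
proof (rule partition_onI)
  show "\<Union> classes = \<Omega> \<times> \<Omega>"
  proof
    show "\<Union> classes \<subseteq> \<Omega> \<times> \<Omega>"
      using sw_sub fibre_sub by (auto simp: classes_def S_def)
    have "(x, y) \<in> \<Union> classes" if "x \<in> \<Omega>" "y \<in> \<Omega>" for x y
      using that sw_three[OF that] by (cases "y \<in> fibre x") (auto simp: classes_def S_def)
    then show "\<Omega> \<times> \<Omega> \<subseteq> \<Union> classes" by auto
  qed
  show "disjnt U V" if "U \<in> classes" "V \<in> classes" "U \<noteq> V" for U V
  proof -
    have d: "disjnt (Id_on \<Omega>) S" "disjnt (Id_on \<Omega>) (sw k)" "disjnt S (sw k)"
      "i mod 3 \<noteq> j mod 3 \<Longrightarrow> disjnt (sw i) (sw j)" for i j k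
      using classes_disjoint by (simp_all add: disjnt_def)
    have "pairwise disjnt classes"
      unfolding classes_def by (auto simp: pairwise_insert d d(1-3)[THEN disjnt_sym])
    then show ?thesis using that by (auto simp: pairwise_def)
  qed
  show "{} \<notin> classes"
    using classes_nonempty by (auto simp: classes_def)
qed

theorem jordan_scheme_classes: "jordan_scheme \<Omega> classes"
proof (rule jordan_schemeI)
  show "sym R" if "R \<in> classes" for R
    using that sw_sym S_sym by (auto simp: classes_def sym_Id_on)
  have both_S: "paths S S x y + paths S S x y = (if y = x then 4 else if y \<in> fibre x then 2 else 0)"
    if "x \<in> \<Omega>" for x y
    using paths_S_S[OF that] by simp
  have S_sw_fibre: "paths S (sw j) x y + paths (sw j) S x y = 0"
    if "x \<in> \<Omega>" "y \<in> fibre x" for x y j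
  proof -
    have "y \<in> \<Omega>" "x \<in> fibre y" using that fibre_sym fibre_sub by blast+
    then show ?thesis
      using paths_S_sw_fibre that by (simp add: paths_sym[OF sw_sym S_sym])
  qed
  have S_sw_off: "paths S (sw j) x y + paths (sw j) S x y = (if k mod 3 = j mod 3 then 0 else 2)"
    if "(x, y) \<in> sw k" for x y j k
    using paths_S_sw[OF that] paths_S_sw[of y x k j] that sw_commute[of x y k]
    by (simp add: paths_sym[OF sw_sym S_sym])
  have sub: "x \<in> \<Omega>" "y \<in> \<Omega>" if "(x, y) \<in> sw k" for x y k
    using that sw_sub by blast+
  show "paths R T x y + paths T R x y = paths R T x' y' + paths T R x' y'"
    if R: "R \<in> classes - {Id_on \<Omega>}" and T: "T \<in> classes - {Id_on \<Omega>}" and U: "U \<in> classes"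
      and xy: "(x, y) \<in> U" "(x', y') \<in> U" for R T U x y x' y'
  proof -
    have "V = S \<or> (\<exists>i\<in>{0, 1, 2}. V = sw i)" if "V \<in> classes - {Id_on \<Omega>}" for V
      using that by (auto simp: classes_def)
    from this[OF R] this[OF T]
    consider (S) "R = S" "T = S"
      | (Ssw) j where "{R, T} = {S, sw j}"
      | (sw) i j where "R = sw i" "T = sw j" "i \<in> {0, 1, 2}" "j \<in> {0, 1, 2}"
      by (auto simp: doubleton_eq_iff)
    note RT = this
    consider (Id) "x = y" "x' = y'" "x \<in> \<Omega>" "x' \<in> \<Omega>"
      | (S) "x \<in> \<Omega>" "y \<in> fibre x" "y \<noteq> x" "x' \<in> \<Omega>" "y' \<in> fibre x'" "y' \<noteq> x'"
      | (sw) k where "(x, y) \<in> sw k" "(x', y') \<in> sw k"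
      using U xy unfolding classes_def S_def by blast
    note U = this
    from RT show ?thesis
    proof cases
      case S
      from U show ?thesis
        by cases (use S both_S sub sw_fibre sw_irrefl in auto)
    next
      case (Ssw j)
      have swap: "paths R T u v + paths T R u v = paths S (sw j) u v + paths (sw j) S u v" for u v
        using Ssw by (auto simp: doubleton_eq_iff)
      from U show ?thesis
        by cases (use swap S_sw_fibre S_sw_off fibre_self in auto)
    next
      case (sw i j)
      from U show ?thesis
      proof cases
        case Id
        then show ?thesis using sw by (simp add: sw_paths_refl)
      next
        case S
        then show ?thesis using sw by (simp add: sw_paths_fibre)
      next
        case (sw k)
        then show ?thesis using \<open>R = sw i\<close> \<open>T = sw j\<close> sw_paths_off sub sw_fibre by metis
      qed
    qed
  qed
qed (simp_all add: fin partition_classes, simp add: classes_def)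

end

section \<open>From valencies to a cyclic cover\<close>

text \<open>Proved for elements of an arbitrary type: for relations, inequalities would be unfolded
  into statements about pairs.\<close>

lemma distinct6:
  assumes "distinct [a, b, c, d, e, f]"
  shows "b \<noteq> a" "c \<noteq> b"
    "\<And>x. x \<in> {d, e, f} \<Longrightarrow> x \<noteq> a \<and> x \<noteq> b \<and> x \<noteq> c"
    "\<And>x y. {x, y} = {e, f} \<Longrightarrow> d \<noteq> x \<and> d \<noteq> y \<and> x \<noteq> y"
  using assms by (auto simp: doubleton_eq_iff)

text \<open>A coherent configuration with the valencies 1, 1, 1, 4, 4, 4 of the 2-orbits. The parameters
  \<open>\<C>\<close> and \<open>\<D>\<close> only abbreviate the set of all classes and the set of the classes of valency 4.\<close>

locale rank6_scheme =
  fixes \<Omega> :: "'a set" and S1 \<Delta>0 \<Delta>1 \<Delta>2 :: "('a \<times> 'a) set" and \<C> \<D> :: "('a \<times> 'a) set set"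
  defines "\<C> \<equiv> {Id_on \<Omega>, S1, S1\<inverse>, \<Delta>0, \<Delta>1, \<Delta>2}" and "\<D> \<equiv> {\<Delta>0, \<Delta>1, \<Delta>2}"
  assumes fin: "finite \<Omega>"
    and part: "partition_on (\<Omega> \<times> \<Omega>) \<C>"
    and dist: "distinct [Id_on \<Omega>, S1, S1\<inverse>, \<Delta>0, \<Delta>1, \<Delta>2]"
    and coh: "coherent \<C>"
    and val1: "has_valency \<Omega> S1 1"
    and val4: "R \<in> \<D> \<Longrightarrow> sym R \<and> has_valency \<Omega> R 4"
begin

definition s :: "'a \<Rightarrow> 'a" where
  "s x = (THE y. (x, y) \<in> S1)"

lemma in_\<C>: "Id_on \<Omega> \<in> \<C>" "S1 \<in> \<C>" "S1\<inverse> \<in> \<C>" "\<Delta> \<in> \<D> \<Longrightarrow> \<Delta> \<in> \<C>"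
  by (auto simp: \<C>_def \<D>_def)

lemma unique: "p \<in> R \<Longrightarrow> p \<in> T \<Longrightarrow> R \<in> \<C> \<Longrightarrow> T \<in> \<C> \<Longrightarrow> R = T"
  using partition_onD2[OF part] by (auto simp: disjoint_def)

lemma \<C>_sub: "R \<in> \<C> \<Longrightarrow> R \<subseteq> \<Omega> \<times> \<Omega>"
  using partition_onD1[OF part] by auto

lemma \<C>_cover: "x \<in> \<Omega> \<Longrightarrow> y \<in> \<Omega> \<Longrightarrow> \<exists>T\<in>\<C>. (x, y) \<in> T"
  using partition_onD1[OF part] by auto

lemma \<C>_distinct:
  "S1 \<noteq> Id_on \<Omega>" "S1\<inverse> \<noteq> S1" "\<Delta> \<in> \<D> \<Longrightarrow> \<Delta> \<noteq> Id_on \<Omega> \<and> \<Delta> \<noteq> S1 \<and> \<Delta> \<noteq> S1\<inverse>"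
  using distinct6[OF dist] unfolding \<D>_def by blast+

lemma S1_iff: "(x, y) \<in> S1 \<longleftrightarrow> x \<in> \<Omega> \<and> y = s x"
proof (cases "x \<in> \<Omega>")
  case True
  then obtain z where z: "S1 `` {x} = {z}"
    using val1 unfolding has_valency_def by (auto simp: card_1_singleton_iff)
  then have "(x, y) \<in> S1 \<longleftrightarrow> y = z" for y by auto
  then show ?thesis using True by (simp add: s_def)
next
  case False
  then show ?thesis using \<C>_sub in_\<C> by blast
qed

lemma s_in: "x \<in> \<Omega> \<Longrightarrow> s x \<in> \<Omega>"
  using S1_iff \<C>_sub in_\<C>(2) by blast

text \<open>The qualitative form of coherence: whether a pair is joined by a path through \<open>R\<close> and \<open>T\<close>
  depends on its class only.\<close>

lemma route:
  assumes "R \<in> \<C>" "T \<in> \<C>" "U \<in> \<C>" "(x, z) \<in> R" "(z, y) \<in> T" "(x, y) \<in> U" "(x', y') \<in> U"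
  shows "\<exists>z'. (x', z') \<in> R \<and> (z', y') \<in> T"
proof -
  have eq: "paths R T x y = paths R T x' y'"
    using coh assms unfolding coherent_def by blast
  have "finite {z. (x, z) \<in> R \<and> (z, y) \<in> T}"
    by (rule finite_subset[OF _ fin]) (use \<C>_sub[OF assms(1)] in auto)
  then have "paths R T x y \<noteq> 0"
    using assms(4,5) by (auto simp: paths_def)
  then have "{z. (x', z) \<in> R \<and> (z, y') \<in> T} \<noteq> {}"
    using eq by (intro notI) (simp only: paths_def card.empty)
  then show ?thesis by blast
qed

lemma s_neq:
  assumes "x \<in> \<Omega>"
  shows "s x \<noteq> x"
proof
  assume "s x = x"
  then have "(x, x) \<in> S1" "(x, x) \<in> Id_on \<Omega>" using assms S1_iff[of x x] by auto
  then show False using unique[OF _ _ in_\<C>(2) in_\<C>(1)] \<C>_distinct(1) by blast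
qed

text \<open>The class of \<open>(x, s (s x))\<close> has valency 1, and it can be neither the diagonal,
  as \<open>S1\<close> is not symmetric, nor \<open>S1\<close>, as \<open>s\<close> has no fixed point. Hence it is the converse of \<open>S1\<close>.\<close>

lemma s_cube:
  assumes x: "x \<in> \<Omega>"
  shows "s (s (s x)) = x"
proof -
  have sx: "s x \<in> \<Omega>" "s (s x) \<in> \<Omega>" using x s_in by blast+
  obtain T where T: "T \<in> \<C>" "(x, s (s x)) \<in> T"
    using \<C>_cover x sx by blast
  have route2: "y = s (s x)" if "(x, y) \<in> T" for y
    using route[OF in_\<C>(2) in_\<C>(2) T(1) _ _ T(2) that, of "s x"] x sx by (simp add: S1_iff)
  have "T \<notin> \<D>"
  proof
    assume "T \<in> \<D>"
    then have "card (T `` {x}) = 4" using val4 x by (auto simp: has_valency_def)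
    moreover have "(x, y) \<in> T \<longleftrightarrow> y = s (s x)" for y using route2 T(2) by blast
    then have "T `` {x} = {s (s x)}" by (simp add: Image_def)
    ultimately show False by simp
  qed
  moreover have "T \<noteq> Id_on \<Omega>"
  proof
    assume "T = Id_on \<Omega>"
    then have "s (s x) = x" using T by auto
    then have "(x, s x) \<in> S1" "(x, s x) \<in> S1\<inverse>" using x sx by (simp_all add: S1_iff)
    then show False using unique[OF _ _ in_\<C>(2) in_\<C>(3)] \<C>_distinct(2) by metis
  qed
  moreover have "T \<noteq> S1" using T s_neq[OF sx(1)] by (auto simp: S1_iff)
  ultimately have "T = S1\<inverse>" using T unfolding \<C>_def \<D>_def by blast
  then show ?thesis using T by (simp add: S1_iff)
qed

lemma \<D>_fibre:
  assumes "\<Delta> \<in> \<D>" "(x, y) \<in> \<Delta>"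
  shows "y \<notin> {x, s x, s (s x)}"
proof -
  have x: "x \<in> \<Omega>" using \<C>_sub in_\<C>(4) assms by blast
  have "(x, x) \<in> Id_on \<Omega>" "(x, s x) \<in> S1" "(x, s (s x)) \<in> S1\<inverse>"
    using x s_in s_cube by (auto simp: S1_iff)
  then have "(x, x) \<notin> \<Delta>" "(x, s x) \<notin> \<Delta>" "(x, s (s x)) \<notin> \<Delta>"
    using unique[OF _ _ in_\<C>(4)] in_\<C>(1-3) assms(1) \<C>_distinct(3) by metis+
  then show ?thesis using assms(2) by auto
qed

lemma \<D>_cover:
  assumes "x \<in> \<Omega>" "y \<in> \<Omega>" "y \<notin> {x, s x, s (s x)}"
  shows "\<exists>\<Delta>\<in>\<D>. (x, y) \<in> \<Delta>"
proof -
  obtain T where T: "T \<in> \<C>" "(x, y) \<in> T"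
    using \<C>_cover assms by blast
  have "T \<noteq> Id_on \<Omega>" "T \<noteq> S1" using T assms by (auto simp: S1_iff)
  moreover have "T \<noteq> S1\<inverse>"
  proof
    assume "T = S1\<inverse>"
    then have "x = s y" using T by (simp add: S1_iff)
    then show False using s_cube assms by auto
  qed
  ultimately show ?thesis using T unfolding \<C>_def \<D>_def by blast
qed

lemma \<D>_step:
  assumes "\<Delta> \<in> \<D>" "(x, y) \<in> \<Delta>"
  shows "\<exists>\<Delta>'\<in>\<D>. (s x, y) \<in> \<Delta>'"
proof (rule \<D>_cover)
  show "s x \<in> \<Omega>" "y \<in> \<Omega>" using assms \<C>_sub in_\<C>(4) s_in by blast+
  have "x \<in> \<Omega>" using assms \<C>_sub in_\<C>(4) by blast
  then show "y \<notin> {s x, s (s x), s (s (s x))}"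
    using \<D>_fibre[OF assms] s_cube by auto
qed

lemma \<D>_step_uniform:
  assumes "\<Delta> \<in> \<D>" "\<Delta>' \<in> \<D>" "(x, y) \<in> \<Delta>" "(s x, y) \<in> \<Delta>'" "(x', y') \<in> \<Delta>"
  shows "(s x', y') \<in> \<Delta>'"
proof -
  have "x \<in> \<Omega>" using assms \<C>_sub in_\<C>(4) by blast
  then have "(x, s x) \<in> S1" by (simp add: S1_iff)
  then show ?thesis
    using route[OF in_\<C>(2) in_\<C>(4) in_\<C>(4) _ assms(4,3,5)] assms(1,2) by (auto simp: S1_iff)
qed

text \<open>Otherwise the four neighbours of \<open>y\<close> in \<open>\<Delta>\<close> would be a union of fibres, of size 3 each.\<close>

lemma \<D>_step_neq:
  assumes \<Delta>: "\<Delta> \<in> \<D>" and xy: "(x, y) \<in> \<Delta>"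
  shows "(s x, y) \<notin> \<Delta>"
proof
  assume "(s x, y) \<in> \<Delta>"
  then have closed: "(s u, v) \<in> \<Delta>" if "(u, v) \<in> \<Delta>" for u v
    using \<D>_step_uniform[OF \<Delta> \<Delta> xy] that by blast
  define N where "N = \<Delta> `` {y}"
  have N: "u \<in> N \<longleftrightarrow> (u, y) \<in> \<Delta>" for u
    using val4[OF \<Delta>] by (auto simp: N_def dest: symD)
  have sub: "N \<subseteq> \<Omega>" and y: "y \<in> \<Omega>" using N xy \<C>_sub[OF in_\<C>(4)[OF \<Delta>]] by auto
  have card: "card N = 4" using val4[OF \<Delta>] y by (simp add: has_valency_def N_def)
  have fibre: "{u, s u, s (s u)} \<subseteq> N" if "u \<in> N" for u using that closed N by auto
  have x: "x \<in> N" "x \<in> \<Omega>" using N xy sub by auto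
  have "card {x, s x, s (s x)} < card N"
    unfolding card by (rule le_less_trans[OF card_insert_le_m1[of 3]]) (auto simp: card_insert_if)
  then obtain w where w: "w \<in> N" "w \<notin> {x, s x, s (s x)}"
    by (metis card_mono finite.emptyI finite_insert not_less subsetI)
  have w\<Omega>: "w \<in> \<Omega>" using w sub by blast
  have sw: "s w \<noteq> w" "s w \<notin> {x, s x, s (s x)}"
    using s_neq[OF w\<Omega>] w(2) s_cube[OF w\<Omega>] s_cube[OF x(2)] by auto
  have neq: "s x \<noteq> x" "s (s x) \<noteq> x" "s (s x) \<noteq> s x"
    using s_neq[OF x(2)] s_neq[OF s_in[OF x(2)]] s_cube[OF x(2)] by auto
  \<comment> \<open>The fibres of \<open>x\<close> and \<open>w\<close> are disjoint, and five of their points already exceed the valency.\<close>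
  have "card {s w, w, x, s x, s (s x)} = 5"
    using neq sw w by auto
  moreover have "card {s w, w, x, s x, s (s x)} \<le> card N"
    using fibre[OF x(1)] fibre[OF w(1)] by (intro card_mono finite_subset[OF sub fin]) auto
  ultimately show False using card by simp
qed

text \<open>By the preceding lemmas \<open>s\<close> acts on the first entry of a pair as a permutation of \<open>\<Delta>0\<close>, \<open>\<Delta>1\<close>,
  \<open>\<Delta>2\<close> without fixed points, that is, as a 3-cycle.\<close>

lemma colour_cycle:
  obtains A B where "{A, B} = {\<Delta>1, \<Delta>2}"
    "\<And>x y. (x, y) \<in> \<Delta>0 \<Longrightarrow> (s x, y) \<in> A" "\<And>x y. (x, y) \<in> A \<Longrightarrow> (s x, y) \<in> B"
    "\<And>x y. (x, y) \<in> B \<Longrightarrow> (s x, y) \<in> \<Delta>0"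
proof -
  have D0: "\<Delta>0 \<in> \<D>" by (simp add: \<D>_def)
  obtain p where "p \<in> \<Delta>0" using partition_onD3[OF part] by (auto simp: \<C>_def)
  then obtain x y where xy: "(x, y) \<in> \<Delta>0" by (cases p) auto
  then have x: "x \<in> \<Omega>" using \<C>_sub[OF in_\<C>(4)[OF D0]] by blast
  obtain A where A: "A \<in> \<D>" "(s x, y) \<in> A" using \<D>_step[OF D0 xy] by blast
  obtain B where B: "B \<in> \<D>" "(s (s x), y) \<in> B" using \<D>_step[OF A] by blast
  have xy': "(s (s (s x)), y) \<in> \<Delta>0" using xy s_cube[OF x] by simp
  have neq: "A \<noteq> \<Delta>0" "B \<noteq> A" "B \<noteq> \<Delta>0"
    using \<D>_step_neq[OF D0 xy] \<D>_step_neq[OF A] \<D>_step_neq[OF B] A B xy' by blast+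
  show thesis
  proof
    show "{A, B} = {\<Delta>1, \<Delta>2}" using neq A(1) B(1) unfolding \<D>_def by blast
  qed (fact \<D>_step_uniform[OF D0 A(1) xy A(2)] \<D>_step_uniform[OF A(1) B(1) A(2) B(2)]
      \<D>_step_uniform[OF B(1) D0 B(2) xy'])+
qed

lemma cyclic_cover_exists:
  obtains D where "cyclic_cover \<Omega> s D" "D 0 = \<Delta>0" "{D 1, D 2} = {\<Delta>1, \<Delta>2}"
proof -
  obtain A B where AB: "{A, B} = {\<Delta>1, \<Delta>2}"
    and step: "\<And>x y. (x, y) \<in> \<Delta>0 \<Longrightarrow> (s x, y) \<in> A" "\<And>x y. (x, y) \<in> A \<Longrightarrow> (s x, y) \<in> B"
    "\<And>x y. (x, y) \<in> B \<Longrightarrow> (s x, y) \<in> \<Delta>0"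
    using colour_cycle by blast
  define D where "D k = (if k mod 3 = 0 then \<Delta>0 else if k mod 3 = 1 then A else B)" for k :: int
  have \<D>: "\<D> = {\<Delta>0, A, B}" using AB by (auto simp: \<D>_def)
  have neq: "\<Delta>0 \<noteq> A" "\<Delta>0 \<noteq> B" "A \<noteq> B" using distinct6(4)[OF dist AB] by simp_all
  have D_in: "D k \<in> \<D>" for k by (simp add: D_def \<D>)
  have D_inj: "j mod 3 = k mod 3" if "D j = D k" for j k
    using that neq mod3_cases[of j] mod3_cases[of k] by (auto simp: D_def split: if_splits)
  have "cyclic_cover \<Omega> s D"
  proof
    show "D k \<subseteq> \<Omega> \<times> \<Omega>" for k by (rule \<C>_sub[OF in_\<C>(4)[OF D_in]])
    show "sym (D k)" for k using val4[OF D_in] by blast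
    show "(x, x) \<notin> D k" for x k using \<D>_fibre[OF D_in] by blast
    show "D j = D k" if "j mod 3 = k mod 3" for j k using that by (simp add: D_def)
    show "j mod 3 = k mod 3" if "(x, y) \<in> D j" "(x, y) \<in> D k" for x y j k
      by (rule D_inj[OF unique[OF that in_\<C>(4)[OF D_in] in_\<C>(4)[OF D_in]]])
    show "(s x, y) \<in> D (k + 1)" if "(x, y) \<in> D k" for x y k
      using that step mod3_cases[of k] by (auto simp: D_def mod3_shift)
    show "\<exists>k. (x, y) \<in> D k" if xy: "x \<in> \<Omega>" "y \<in> \<Omega>" "y \<notin> {x, s x, s (s x)}" for x y
    proof -
      have "D 0 = \<Delta>0" "D 1 = A" "D 2 = B" by (simp_all add: D_def)
      then show ?thesis using \<D>_cover[OF xy] unfolding \<D> by blast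
    qed
    show "card (D k `` {x}) = 4" if "x \<in> \<Omega>" for x k
      using val4[OF D_in] that by (simp add: has_valency_def)
    show "paths (D i) (D j) x y = paths (D i) (D j) x' y'"
      if "(x, y) \<in> D k" "(x', y') \<in> D k" for x y x' y' i j k
      using coh in_\<C>(4)[OF D_in] that unfolding coherent_def by blast
  qed (use fin s_in s_cube s_neq in auto)
  then show thesis by (rule that) (use AB in \<open>simp_all add: D_def\<close>)
qed

end

section \<open>The scheme on 15 points\<close>

lemma (in switched_cover) sw_eq: "sw k = continent_part \<Omega> I (D k) \<union> bridge \<Omega> I (D (- k))"
proof -
  have *: "x \<in> \<Omega> \<and> y \<in> \<Omega> \<and> \<not> (x \<in> I \<and> y \<in> I)" if "(x, y) \<in> D j" for x y j
    using that D_fibre I_fibre D_in by blast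
  have "(x, y) \<in> sw k \<longleftrightarrow> (x, y) \<in> continent_part \<Omega> I (D k) \<union> bridge \<Omega> I (D (- k))" for x y
    using *[of x y k] *[of x y "- k"] by (auto simp: sw_def bridge_sign_def continent_part_def bridge_def)
  then show ?thesis by auto
qed

lemma (in switched_cover) classes_eq_switched_graph:
  "classes = switched_graph \<Omega> I S (D 0) (D 1) (D 2)"
proof -
  have "D (- 1) = D 2" "D (- 2) = D 1" by (rule D_mod; simp)+
  moreover have "sw 0 = D 0" by (simp add: sw_def)
  ultimately show ?thesis
    by (simp add: classes_def switched_graph_def sw_eq[of 1] sw_eq[of 2])
qed

text \<open>The cycle of colours runs through \<open>\<Delta>1\<close> and \<open>\<Delta>2\<close> in an unknown order; the switched graph does
  not distinguish them.\<close>

lemma switched_graph_commute: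
  "switched_graph \<Omega> I S \<Delta>0 \<Delta>1 \<Delta>2 = switched_graph \<Omega> I S \<Delta>0 \<Delta>2 \<Delta>1"
  by (auto simp: switched_graph_def)

theorem proposition12p2:
  fixes S1 S \<Delta>0 \<Delta>1 \<Delta>2 :: "(nat set set \<times> nat set set) set"
    and island :: "nat set set set"
    and J15 :: "(nat set set \<times> nat set set) set set"
  assumes "NJ15_labelling S1 \<Delta>0 \<Delta>1 \<Delta>2"
    and "S = S1 \<union> S1\<inverse>"
    and "island \<in> Omega15 // (Id_on Omega15 \<union> S)"
    and "J15 = switched_graph Omega15 island S \<Delta>0 \<Delta>1 \<Delta>2"
  shows "card Omega15 = 15 \<and> card J15 = 5 \<and> jordan_scheme Omega15 J15"
proof -
  have orbits: "two_orbits = {Id_on Omega15, S1, S1\<inverse>, \<Delta>0, \<Delta>1, \<Delta>2}"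
    using assms(1) by (simp add: NJ15_labelling_def)
  interpret R: rank6_scheme Omega15 S1 \<Delta>0 \<Delta>1 \<Delta>2 two_orbits "{\<Delta>0, \<Delta>1, \<Delta>2}"
    using assms(1) partition_two_orbits coherent_two_orbits
    by unfold_locales (auto simp only: NJ15_labelling_def orbits finite_Omega15)
  obtain D where D: "cyclic_cover Omega15 R.s D" "D 0 = \<Delta>0" "{D 1, D 2} = {\<Delta>1, \<Delta>2}"
    by (rule R.cyclic_cover_exists)
  interpret C: cyclic_cover Omega15 R.s D by (rule D(1))
  obtain a where a: "a \<in> Omega15" "island = (Id_on Omega15 \<union> S) `` {a}"
    using assms(3) by (auto elim: quotientE)
  have S: "(x, y) \<in> S \<longleftrightarrow> x \<in> Omega15 \<and> y \<in> C.fibre x \<and> y \<noteq> x" for x y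
    using R.s_in R.s_cube C.s_neq[of x] C.s_neq[of y] C.s2_neq[of x] unfolding assms(2)
    by (auto simp: R.S1_iff C.fibre_def)
  have "island = C.fibre a"
    using a S C.fibre_self by auto
  then interpret J: switched_cover Omega15 R.s D island
    using a by unfold_locales blast
  have "S = J.S" using S by (auto simp: J.S_def)
  then have "J15 = J.classes"
    using assms(4) D(2,3) J.classes_eq_switched_graph switched_graph_commute
    by (metis doubleton_eq_iff)
  then show ?thesis
    using C.card_Omega[OF a(1)] J.card_classes J.jordan_scheme_classes by simp
qed

end
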